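(* Let $n\ge 2$ be an integer and let $a=N_a(\sinh\theta+\varepsilon\cosh\theta)\in S_3$, where $\theta\in\mathbb{R}$ and $\varepsilon\in E_1$. Then the equation $w^n=a$, with unknown $w\in C\ell_2$, has (i) no root if $n$ is an even number; (ii) only one root $w=\sqrt[n]{N_a}\big(\sinh\frac{\theta}{n}+\varepsilon\cosh\frac{\theta}{n}\big)$ if $n$ is an odd number.
   Context: $C\ell_2=C\ell_{2,0}$ is the associative unital real algebra with $\mathbb{R}$-basis $\mathbf{e}_0=1,\mathbf{e}_1,\mathbf{e}_2,\mathbf{e}_3$ and multiplication rules $\mathbf{e}_1^2=\mathbf{e}_2^2=1$, $\mathbf{e}_3^2=-1$, $\mathbf{e}_1\mathbf{e}_2=\mathbf{e}_3=-\mathbf{e}_2\mathbf{e}_1$, $\mathbf{e}_2\mathbf{e}_3=-\mathbf{e}_1=-\mathbf{e}_3\mathbf{e}_2$, $\mathbf{e}_3\mathbf{e}_1=-\mathbf{e}_2=-\mathbf{e}_1\mathbf{e}_3$. For $a=a_0+a_1\mathbf{e}_1+a_2\mathbf{e}_2+a_3\mathbf{e}_3$ with $a_i\in\mathbb{R}$: $I_a=a_0^2-a_1^2-a_2^2+a_3^2$, $N_a=\sqrt{|I_a|}$, $V_a=a_1^2+a_2^2-a_3^2$. $S_3=\{a\in C\ell_2: I_a<0,\ V_a>0\}$. $E_1=\{\epsilon_1\mathbf{e}_1+\epsilon_2\mathbf{e}_2+\epsilon_3\mathbf{e}_3:\epsilon_i\in\mathbb{R},\ \epsilon_1^2+\epsilon_2^2-\epsilon_3^2=1\}$.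 $\sqrt[n]{\cdot}$ is the real $n$th root. *)

theory Defs
  imports Complex_Main
begin

text \<open>
  The real Clifford algebra of signature (2,0): \<^term>\<open>Cl2 a0 a1 a2 a3\<close> stands for
  the element a0 + a1 e1 + a2 e2 + a3 e3. The lemmas \<open>cl2_mult_table\<close> and
  \<open>cl2_expansion\<close> below confirm the multiplication rules and the basis expansion.
\<close>

datatype cl2 = Cl2 (cl2_0: real) (cl2_1: real) (cl2_2: real) (cl2_3: real)

lemma cl2_eq_iff:
  "a = b \<longleftrightarrow> cl2_0 a = cl2_0 b \<and> cl2_1 a = cl2_1 b \<and> cl2_2 a = cl2_2 b \<and> cl2_3 a = cl2_3 b"
  by (cases a; cases b) simp

instantiation cl2 :: real_algebra_1
begin

definition zero_cl2 :: cl2 where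
  "zero_cl2 = Cl2 0 0 0 0"

definition one_cl2 :: cl2 where
  "one_cl2 = Cl2 1 0 0 0"

definition plus_cl2 :: "cl2 \<Rightarrow> cl2 \<Rightarrow> cl2" where
  "a + b = Cl2 (cl2_0 a + cl2_0 b) (cl2_1 a + cl2_1 b) (cl2_2 a + cl2_2 b) (cl2_3 a + cl2_3 b)"

definition uminus_cl2 :: "cl2 \<Rightarrow> cl2" where
  "- a = Cl2 (- cl2_0 a) (- cl2_1 a) (- cl2_2 a) (- cl2_3 a)"

definition minus_cl2 :: "cl2 \<Rightarrow> cl2 \<Rightarrow> cl2" where
  "a - b = Cl2 (cl2_0 a - cl2_0 b) (cl2_1 a - cl2_1 b) (cl2_2 a - cl2_2 b) (cl2_3 a - cl2_3 b)"

definition scaleR_cl2 :: "real \<Rightarrow> cl2 \<Rightarrow> cl2" where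
  "r *\<^sub>R a = Cl2 (r * cl2_0 a) (r * cl2_1 a) (r * cl2_2 a) (r * cl2_3 a)"

definition times_cl2 :: "cl2 \<Rightarrow> cl2 \<Rightarrow> cl2" where
  "a * b = Cl2
     (cl2_0 a * cl2_0 b + cl2_1 a * cl2_1 b + cl2_2 a * cl2_2 b - cl2_3 a * cl2_3 b)
     (cl2_0 a * cl2_1 b + cl2_1 a * cl2_0 b - cl2_2 a * cl2_3 b + cl2_3 a * cl2_2 b)
     (cl2_0 a * cl2_2 b + cl2_2 a * cl2_0 b + cl2_1 a * cl2_3 b - cl2_3 a * cl2_1 b)
     (cl2_0 a * cl2_3 b + cl2_3 a * cl2_0 b + cl2_1 a * cl2_2 b - cl2_2 a * cl2_1 b)"

instance
  by standard
    (simp_all add: cl2_eq_iff zero_cl2_def one_cl2_def plus_cl2_def uminus_cl2_def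
      minus_cl2_def scaleR_cl2_def times_cl2_def algebra_simps)

end

definition e1 :: cl2 where "e1 = Cl2 0 1 0 0"
definition e2 :: cl2 where "e2 = Cl2 0 0 1 0"
definition e3 :: cl2 where "e3 = Cl2 0 0 0 1"

lemma cl2_expansion:
  "Cl2 a0 a1 a2 a3 = of_real a0 + a1 *\<^sub>R e1 + a2 *\<^sub>R e2 + a3 *\<^sub>R e3"
  by (simp add: of_real_def one_cl2_def plus_cl2_def scaleR_cl2_def e1_def e2_def e3_def)

lemma cl2_mult_table:
  "e1 * e1 = 1" "e2 * e2 = 1" "e3 * e3 = - 1"
  "e1 * e2 = e3" "e2 * e1 = - e3"
  "e2 * e3 = - e1" "e3 * e2 = e1"
  "e3 * e1 = - e2" "e1 * e3 = e2"
  by (simp_all add: one_cl2_def uminus_cl2_def times_cl2_def e1_def e2_def e3_def)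

definition cl2_I :: "cl2 \<Rightarrow> real" where
  "cl2_I a = (cl2_0 a)\<^sup>2 - (cl2_1 a)\<^sup>2 - (cl2_2 a)\<^sup>2 + (cl2_3 a)\<^sup>2"

definition cl2_N :: "cl2 \<Rightarrow> real" where
  "cl2_N a = sqrt \<bar>cl2_I a\<bar>"

definition cl2_V :: "cl2 \<Rightarrow> real" where
  "cl2_V a = (cl2_1 a)\<^sup>2 + (cl2_2 a)\<^sup>2 - (cl2_3 a)\<^sup>2"

definition S3 :: "cl2 set" where
  "S3 = {a. cl2_I a < 0 \<and> cl2_V a > 0}"

definition E1 :: "cl2 set" where
  "E1 = {x1 *\<^sub>R e1 + x2 *\<^sub>R e2 + x3 *\<^sub>R e3 | x1 x2 x3 :: real. x1\<^sup>2 + x2\<^sup>2 - x3\<^sup>2 = 1}"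

end

theory Submission
  imports Defs
begin

text \<open>
  The form \<^term>\<open>cl2_I\<close> is multiplicative, so an even power cannot have \<^term>\<open>cl2_I\<close> negative.
  For odd \<open>n\<close>, a root \<open>w\<close> of \<open>a\<close> commutes with \<open>a\<close>, hence with \<open>\<epsilon>\<close>, and therefore lies in the
  commutative subalgebra \<open>\<real> + \<real>\<epsilon>\<close>. As \<open>\<epsilon>\<^sup>2 = 1\<close>, this subalgebra is \<open>\<real> \<times> \<real>\<close> via the idempotents
  \<open>(1 \<plusminus> \<epsilon>) / 2\<close>, where \<open>a\<close> has the coordinates \<open>N e\<^sup>\<theta>\<close> and \<open>- N e\<^sup>-\<^sup>\<theta>\<close>; each of them has exactly
  one real \<open>n\<close>th root.
\<close>

lemmas cl2_defs = cl2_eq_iff zero_cl2_def one_cl2_def plus_cl2_def uminus_cl2_def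
  minus_cl2_def scaleR_cl2_def times_cl2_def of_real_def e1_def e2_def e3_def

text \<open>Under the isomorphism of the algebra with real 2 by 2 matrices, \<open>cl2_I\<close> is
  the determinant.\<close>

lemma cl2_I_mult: "cl2_I (a * b) = cl2_I a * cl2_I b"
  by (simp add: cl2_I_def cl2_defs) algebra

lemma cl2_I_power: "cl2_I (a ^ n) = cl2_I a ^ n"
  by (induction n) (simp_all add: cl2_I_mult, simp add: cl2_I_def one_cl2_def)

text \<open>This is \<open>p (1 + e) / 2 + q (1 - e) / 2\<close>, regrouped in terms of
  \<open>1\<close> and \<open>e\<close>.\<close>

definition from_idem :: "'a::real_algebra_1 \<Rightarrow> real \<Rightarrow> real \<Rightarrow> 'a" where
  "from_idem e p q = of_real ((p + q) / 2) + ((p - q) / 2) *\<^sub>R e"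

lemma from_idem_mult:
  assumes "e * e = 1"
  shows "from_idem e p q * from_idem e p' q' = from_idem e (p * p') (q * q')"
proof -
  have "(of_real x + y *\<^sub>R e) * (of_real x' + y' *\<^sub>R e)
      = of_real (x * x' + y * y') + (x * y' + y * x') *\<^sub>R e" for x y x' y'
    using assms by (simp add: of_real_def algebra_simps)
  moreover have "(p + q) / 2 * ((p' + q') / 2) + (p - q) / 2 * ((p' - q') / 2) = (p * p' + q * q') / 2"
    "(p + q) / 2 * ((p' - q') / 2) + (p - q) / 2 * ((p' + q') / 2) = (p * p' - q * q') / 2"
    by (simp_all add: field_simps)
  ultimately show ?thesis by (simp only: from_idem_def)
qed

lemma from_idem_power:
  assumes "e * e = 1"
  shows "from_idem e p q ^ n = from_idem e (p ^ n) (q ^ n)"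
proof (induction n)
  case 0
  show ?case by (simp add: from_idem_def)
qed (simp add: from_idem_mult[OF assms])

text \<open>The coordinates are \<open>sinh t + cosh t = exp t\<close> and
  \<open>sinh t - cosh t = - exp (- t)\<close>, scaled by \<open>r\<close>.\<close>

lemma from_idem_exp:
  "from_idem e (r * exp t) (- (r * exp (- t))) = r *\<^sub>R (of_real (sinh t) + cosh t *\<^sub>R e)"
proof -
  have "(r * exp t + - (r * exp (- t))) / 2 = r * sinh t"
    "(r * exp t - - (r * exp (- t))) / 2 = r * cosh t"
    by (simp_all add: sinh_def cosh_def field_simps)
  then show ?thesis
    by (simp only: from_idem_def) (simp add: of_real_def scaleR_add_right)
qed

lemma E1_cases:
  assumes "\<epsilon> \<in> E1"
  obtains x y z where "\<epsilon> = Cl2 0 x y z" "x\<^sup>2 + y\<^sup>2 - z\<^sup>2 = 1"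
  using assms by (auto simp: E1_def cl2_defs)

lemma E1_square:
  assumes "\<epsilon> \<in> E1"
  shows "\<epsilon> * \<epsilon> = 1"
  using assms by (auto elim!: E1_cases simp: cl2_defs power2_eq_square)

lemma from_idem_E1_inject:
  assumes "\<epsilon> \<in> E1" and eq: "from_idem \<epsilon> p q = from_idem \<epsilon> p' q'"
  shows "p = p'" "q = q'"
proof -
  obtain x y z where \<epsilon>: "\<epsilon> = Cl2 0 x y z" "x\<^sup>2 + y\<^sup>2 - z\<^sup>2 = 1"
    using assms(1) by (rule E1_cases)
  have sum: "p + q = p' + q'"
    and "(p - q) * x = (p' - q') * x" "(p - q) * y = (p' - q') * y"
    using eq by (auto simp: from_idem_def \<epsilon>(1) cl2_defs)
  \<comment> \<open>A nonzero component of \<epsilon> outside \<open>z\<close> allows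
    \<open>p - q\<close> to be cancelled out.\<close>
  moreover have "x \<noteq> 0 \<or> y \<noteq> 0"
  proof (rule ccontr)
    assume "\<not> (x \<noteq> 0 \<or> y \<noteq> 0)"
    with \<epsilon>(2) have "- z\<^sup>2 = 1" by simp
    then show False using zero_le_power2[of z] by linarith
  qed
  ultimately have "p - q = p' - q'" by auto
  with sum show "p = p'" "q = q'" by auto
qed

lemma E1_commute_imp_from_idem:
  assumes "\<epsilon> \<in> E1" and comm: "w * \<epsilon> = \<epsilon> * w"
  obtains p q where "w = from_idem \<epsilon> p q"
proof -
  obtain x y z where \<epsilon>: "\<epsilon> = Cl2 0 x y z" and norm: "x\<^sup>2 + y\<^sup>2 - z\<^sup>2 = 1"
    using assms(1) by (rule E1_cases)
  obtain w0 w1 w2 w3 where w: "w = Cl2 w0 w1 w2 w3" by (cases w)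
  \<comment> \<open>Commuting makes the vector parts of \<open>w\<close> and \<epsilon> parallel:
    their 2 by 2 minors vanish.\<close>
  have c: "w2 * z = w3 * y" "w1 * z = w3 * x" "w1 * y = w2 * x"
    using comm by (auto simp: \<epsilon> w cl2_defs algebra_simps)
  \<comment> \<open>The pairing of \<open>w\<close> with \<epsilon> in the form of signature (2,1);
    as \<epsilon> has norm 1 there, it gives the factor of proportionality.\<close>
  define k where "k = w1 * x + w2 * y - w3 * z"
  have "k * x = w1" "k * y = w2" "k * z = w3"
    using c norm unfolding k_def by algebra+
  then have "w = from_idem \<epsilon> (w0 + k) (w0 - k)"
    by (simp add: from_idem_def \<epsilon> w cl2_defs)
  then show thesis by (rule that)
qed

theorem theorem3p3:
  fixes n :: nat and a \<epsilon> :: cl2 and \<theta> :: real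
  assumes "n \<ge> 2"
    and "a \<in> S3"
    and "\<epsilon> \<in> E1"
    and "a = cl2_N a *\<^sub>R (of_real (sinh \<theta>) + cosh \<theta> *\<^sub>R \<epsilon>)"
  shows "(even n \<longrightarrow> \<not> (\<exists>w :: cl2. w ^ n = a)) \<and>
         (odd n \<longrightarrow> {w :: cl2. w ^ n = a} =
            {root n (cl2_N a) *\<^sub>R
              (of_real (sinh (\<theta> / real n)) + cosh (\<theta> / real n) *\<^sub>R \<epsilon>)})"
proof (intro conjI impI)
  have I_neg: "cl2_I a < 0" using assms(2) by (simp add: S3_def)
  show "\<not> (\<exists>w. w ^ n = a)" if "even n"
  proof
    assume "\<exists>w. w ^ n = a"
    then obtain w where "cl2_I a = cl2_I w ^ n" using cl2_I_power by metis
    with I_neg show False using zero_le_even_power[OF that, of "cl2_I w"] by linarith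
  qed
  assume "odd n"
  define N where "N = cl2_N a"
  have "N > 0" using I_neg by (simp add: N_def cl2_N_def)
  define t where "t = \<theta> / real n"
  \<comment> \<open>\<open>P\<close> and \<open>Q\<close> are the idempotent coordinates of the
    claimed root; oddness of \<open>n\<close> preserves the sign of \<open>Q\<close> in
    \<open>Q ^ n\<close>.\<close>
  define P where "P = root n N * exp t"
  define Q where "Q = - (root n N * exp (- t))"
  have "real n * t = \<theta>" "root n N ^ n = N"
    using assms(1) \<open>N > 0\<close> by (simp_all add: t_def)
  then have "P ^ n = N * exp \<theta>" "Q ^ n = - (N * exp (- \<theta>))"
    using \<open>odd n\<close> by (simp_all add: P_def Q_def power_mult_distrib flip: exp_of_nat_mult)
  then have a: "a = from_idem \<epsilon> (P ^ n) (Q ^ n)"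
    using assms(4) by (simp add: from_idem_exp N_def)
  have "w ^ n = a \<longleftrightarrow> w = from_idem \<epsilon> P Q" for w
  proof
    assume w: "w ^ n = a"
    have "w * a = a * w" by (simp flip: w add: power_commutes)
    \<comment> \<open>The scalar part of \<open>a\<close> is central and cancels, leaving only its
      \<epsilon> part, whose coefficient is positive.\<close>
    then have "(N * cosh \<theta>) *\<^sub>R (w * \<epsilon>) = (N * cosh \<theta>) *\<^sub>R (\<epsilon> * w)"
      by (subst (asm) (1 2) assms(4)) (simp add: N_def of_real_def algebra_simps)
    then have "w * \<epsilon> = \<epsilon> * w"
      using \<open>N > 0\<close> cosh_real_pos[of \<theta>] by simp
    then obtain p q where pq: "w = from_idem \<epsilon> p q"
      using E1_commute_imp_from_idem assms(3) by blast
    have "from_idem \<epsilon> (p ^ n) (q ^ n) = from_idem \<epsilon> (P ^ n) (Q ^ n)"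
      using w a by (simp add: pq from_idem_power E1_square assms(3))
    then have "p ^ n = P ^ n" "q ^ n = Q ^ n"
      using from_idem_E1_inject[OF assms(3)] by blast+
    then have "p = P" "q = Q"
      using odd_real_root_power_cancel[OF \<open>odd n\<close>] by metis+
    with pq show "w = from_idem \<epsilon> P Q" by simp
  qed (simp add: a from_idem_power E1_square assms(3))
  then show "{w. w ^ n = a} = {root n (cl2_N a) *\<^sub>R
      (of_real (sinh (\<theta> / real n)) + cosh (\<theta> / real n) *\<^sub>R \<epsilon>)}"
    by (simp add: P_def Q_def from_idem_exp N_def t_def)
qed

end
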